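(* Let $G$ be a finite simple connected graph. Then the fault tolerant zero forcing number $\mathrm{Z}_t(G)$ exists (i.e., $G$ has at least one fault tolerant zero forcing set) if and only if $G \not\cong K_1$.
   Context: Zero forcing: given a set $B\subseteq V(G)$ of initially blue vertices (all others white), the color change rule allows a blue vertex $b$ to turn a white vertex $w$ blue if $w$ is the unique white neighbor of $b$ (written $b\to w$). $B$ is a zero forcing set if repeated application of this rule eventually turns all of $V(G)$ blue. For an integer $k\ge 1$, a set $B\subseteq V(G)$ with $|B|=m\ge k$ is a $k$-fault tolerant zero forcing set if every subset $F\subseteq B$ with $|F|=m-k$ is a zero forcing set of $G$. The $k$-fault tolerant zero forcing number $\mathrm{Z}_t^k(G)$ is the minimum cardinality of a $k$-fault tolerant zero forcing set of $G$; it is said not to exist if no such set exists. $\mathrm{Z}_t(G)$ denotes $\mathrm{Z}_t^1(G)$, and a $1$-fault tolerant zero forcing set is called a fault tolerant zero forcing set. *)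

theory Defs
  imports "Graph_Theory.Graph_Theory"
begin

text \<open>
  A finite simple graph is an instance of the locale \<open>graph\<close> (finite, loop-free, symmetric
  digraph without parallel arcs), so \<open>b \<rightarrow>\<^bsub>G\<^esub> w\<close> is adjacency. It must not be confused with
  the forcing arrow: a force of \<open>w\<close> by \<open>b\<close> is one step of \<open>color_change\<close>, which relates the
  sets of blue vertices before and after it.
\<close>

definition color_change :: "('a,'b) pre_digraph \<Rightarrow> 'a set \<Rightarrow> 'a set \<Rightarrow> bool" where
  "color_change G S T \<longleftrightarrow>
     (\<exists>b\<in>S. \<exists>w. {v \<in> verts G - S. b \<rightarrow>\<^bsub>G\<^esub> v} = {w} \<and> T = insert w S)"

definition zero_forcing_set :: "('a,'b) pre_digraph \<Rightarrow> 'a set \<Rightarrow> bool" where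
  "zero_forcing_set G B \<longleftrightarrow> B \<subseteq> verts G \<and> (color_change G)\<^sup>*\<^sup>* B (verts G)"

definition k_fault_tolerant_zfs :: "nat \<Rightarrow> ('a,'b) pre_digraph \<Rightarrow> 'a set \<Rightarrow> bool" where
  "k_fault_tolerant_zfs k G B \<longleftrightarrow>
     1 \<le> k \<and> B \<subseteq> verts G \<and> k \<le> card B \<and>
     (\<forall>F. F \<subseteq> B \<and> card F = card B - k \<longrightarrow> zero_forcing_set G F)"

text \<open>The value \<open>None\<close> says that the number does not exist.\<close>

definition k_fault_tolerant_zf_number :: "nat \<Rightarrow> ('a,'b) pre_digraph \<Rightarrow> nat option" where
  "k_fault_tolerant_zf_number k G =
     (if \<exists>B. k_fault_tolerant_zfs k G B
      then Some (LEAST m. \<exists>B. k_fault_tolerant_zfs k G B \<and> card B = m)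
      else None)"

abbreviation fault_tolerant_zfs :: "('a,'b) pre_digraph \<Rightarrow> 'a set \<Rightarrow> bool" where
  "fault_tolerant_zfs \<equiv> k_fault_tolerant_zfs 1"

abbreviation fault_tolerant_zf_number :: "('a,'b) pre_digraph \<Rightarrow> nat option" where
  "fault_tolerant_zf_number \<equiv> k_fault_tolerant_zf_number 1"

lemma k_fault_tolerant_zf_number_exists_iff:
  "(\<exists>m. k_fault_tolerant_zf_number k G = Some m) \<longleftrightarrow> (\<exists>B. k_fault_tolerant_zfs k G B)"
  by (simp add: k_fault_tolerant_zf_number_def)

end

theory Submission
  imports Defs
begin

text \<open>
  If every vertex has a neighbour, the set of all vertices is fault tolerant: a single missing
  vertex is the unique white vertex, so it is forced by any of its neighbours. Conversely, in
  \<open>K\<^sub>1\<close> removing one vertex from a nonempty set leaves no blue vertex to start from.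
\<close>

lemma not_color_change_empty: "\<not> color_change G {} T"
  by (simp add: color_change_def)

text \<open>No force is possible without a blue vertex, so the closure relates \<open>{}\<close>
  only to itself.\<close>

lemma zero_forcing_set_empty_iff: "zero_forcing_set G {} \<longleftrightarrow> verts G = {}"
  unfolding zero_forcing_set_def
  by (auto elim: converse_rtranclpE simp: not_color_change_empty)

text \<open>\<open>wf_digraph\<close> allows loops, so \<open>u \<noteq> v\<close> is what
  guarantees that the forcing vertex \<open>u\<close> is blue.\<close>

lemma (in wf_digraph) zero_forcing_set_remove_vertex:
  assumes "u \<rightarrow> v" and "u \<noteq> v"
  shows "zero_forcing_set G (verts G - {v})"
proof -
  have uv: "u \<in> verts G" "v \<in> verts G"
    using assms(1) by auto
  have "{x \<in> verts G - (verts G - {v}). u \<rightarrow> x} = {v}"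
    using assms(1) uv by auto
  then have "color_change G (verts G - {v}) (verts G)"
    unfolding color_change_def using assms(2) uv by (intro bexI[of _ u] exI[of _ v]) auto
  then show ?thesis
    unfolding zero_forcing_set_def by auto
qed

lemma (in fin_digraph) fault_tolerant_zfs_verts:
  assumes "verts G \<noteq> {}"
    and nbr: "\<And>v. v \<in> verts G \<Longrightarrow> \<exists>u. u \<rightarrow> v \<and> u \<noteq> v"
  shows "fault_tolerant_zfs G (verts G)"
proof -
  have pos: "1 \<le> card (verts G)"
    using assms(1) by (simp add: Suc_le_eq card_gt_0_iff)
  have "zero_forcing_set G F" if F: "F \<subseteq> verts G" "card F = card (verts G) - 1" for F
  proof -
    \<comment> \<open>Subtraction is truncated: n - (n - 1) = 1 relies on
      \<open>pos\<close>.\<close>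
    have "card (verts G - F) = 1"
      using F pos by (simp add: card_Diff_subset finite_subset[OF F(1)])
    then obtain v where "verts G - F = {v}"
      by (auto simp: card_1_singleton_iff)
    then have "v \<in> verts G" "F = verts G - {v}"
      using F(1) by auto
    then show ?thesis
      using nbr zero_forcing_set_remove_vertex by metis
  qed
  then show ?thesis
    using pos by (auto simp: k_fault_tolerant_zfs_def)
qed

text \<open>A path from \<open>v\<close> to any other vertex starts with an arc out of
  \<open>v\<close>, and symmetry reverses that arc.\<close>

lemma (in graph) connected_has_neighbour:
  assumes "Digraph_Component.connected G" and v: "v \<in> verts G" and "verts G \<noteq> {v}"
  shows "\<exists>u. u \<rightarrow> v \<and> u \<noteq> v"
proof -
  obtain w where w: "w \<in> verts G" "w \<noteq> v"
    using assms by auto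
  \<comment> \<open>\<open>connected\<close> is strong connectivity of the symmetric closure; the
    arcs of \<open>G\<close> are already symmetric.\<close>
  have "strongly_connected G"
    using assms(1) symmetric_connected_imp_strongly_connected sym_arcs by blast
  then have "v \<rightarrow>\<^sup>* w"
    using w v by (auto elim: strongly_connectedE)
  then obtain u where "v \<rightarrow> u"
    using w(2) by (auto elim: converse_reachable_cases)
  then show ?thesis
    using adj_not_same graph_symmetric by blast
qed

text \<open>Being isomorphic to \<open>K\<^sub>1\<close> is a matter of the vertex set alone, since
  without loops a single vertex carries no arcs.\<close>

lemma (in graph) complete_digraph_1_iff:
  "complete_digraph 1 G \<longleftrightarrow> (\<exists>v. verts G = {v})"
proof
  assume "\<exists>v. verts G = {v}"
  then obtain v where v: "verts G = {v}" ..
  then have "arcs_ends G = {}"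
    using adj_not_same adj_in_verts by fastforce
  with v show "complete_digraph 1 G"
    unfolding complete_digraph_def using graph_axioms by auto
qed (auto simp: complete_digraph_def card_1_singleton_iff)

lemma not_fault_tolerant_zfs_singleton:
  assumes "verts G = {v}"
  shows "\<not> fault_tolerant_zfs G B"
proof
  assume B: "fault_tolerant_zfs G B"
  \<comment> \<open>The bound \<open>k \<le> card B\<close> with k = 1 excludes
    \<open>B = {}\<close>.\<close>
  then have "B = {v}"
    using assms by (auto simp: k_fault_tolerant_zfs_def subset_singleton_iff)
  \<comment> \<open>Here \<open>card B - 1 = 0\<close>, so \<open>F = {}\<close> is the subset to
    test.\<close>
  then have "zero_forcing_set G {}"
    using B by (auto simp: k_fault_tolerant_zfs_def)
  then show False
    using assms by (simp add: zero_forcing_set_empty_iff)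
qed

theorem theorem2p10:
  fixes G :: "('a,'b) pre_digraph"
  assumes "graph G" and "Digraph_Component.connected G"
  shows "(\<exists>m. fault_tolerant_zf_number G = Some m) \<longleftrightarrow> \<not> complete_digraph 1 G"
proof -
  interpret graph G by fact
  \<comment> \<open>Strong connectivity includes having a vertex, which rules out the empty
    graph.\<close>
  have "verts G \<noteq> {}"
    using assms(2) by (simp add: connected_def strongly_connected_def)
  then have "\<exists>B. fault_tolerant_zfs G B" if "\<not> (\<exists>v. verts G = {v})"
    using fault_tolerant_zfs_verts connected_has_neighbour[OF assms(2)] that
    by metis
  then show ?thesis
    unfolding k_fault_tolerant_zf_number_exists_iff complete_digraph_1_iff
    using not_fault_tolerant_zfs_singleton by metis
qed

end
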